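(* Let $\nu,x\geq 0$ be real numbers and let $\alpha_0=-\log(\sqrt{2}-1)$. If $\nu+1\leq x$, then $$\exp\left(-\frac{\nu+1}{x}\right)\leq \frac{I_{\nu+1}(x)}{I_{\nu}(x)}\leq \exp\left(-\alpha_0\,\frac{\nu+\frac12}{x}\right).$$
   Context: $I_\nu$ denotes the modified Bessel function of the first kind, $I_{\nu}(x)=\sum_{k=0}^{\infty}\frac{1}{k!\,\Gamma(k+\nu+1)}\left(\frac{x}{2}\right)^{2k+\nu}$. $\log$ is the natural logarithm. *)

theory Defs
  imports "HOL-Analysis.Analysis"
begin

(* Modified Bessel function of the first kind, of real order, meant for arguments x > 0.
   Pitfall: 0 powr 0 = 0, so bessel_I 0 0 evaluates to 0 and not to the usual value 1. *)
definition bessel_I :: "real \<Rightarrow> real \<Rightarrow> real" where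
  "bessel_I \<nu> x =
     (\<Sum>k. 1 / (fact k * Gamma (real k + \<nu> + 1)) * (x / 2) powr (2 * real k + \<nu>))"

end

theory Submission imports Defs begin

text \<open>
  Write \<open>r = I\<^bsub>\<nu>+1\<^esub>(x) / I\<^bsub>\<nu>\<^esub>(x)\<close>, \<open>s = (\<nu> + 1) / x\<close> and \<open>t = (\<nu> + 1/2) / x\<close>. The
  Vandermonde identity gives a closed form for the coefficients of the product \<open>I\<^bsub>\<mu>\<^esub> I\<^bsub>\<nu>\<^esub>\<close>, and
  comparing coefficients yields the Turan inequality \<open>I\<^bsub>\<nu>\<^esub> I\<^bsub>\<nu>+2\<^esub> \<le> I\<^bsub>\<nu>+1\<^esub>\<^sup>2\<close> and the inequality
  \<open>r\<^sup>2 + 2 t r \<le> 1\<close>. By the three-term recurrence, the former says \<open>1 \<le> r\<^sup>2 + 2 s r\<close>. In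
  terms of \<open>w = - ln r\<close> the two bounds read \<open>t \<le> sinh w \<le> s\<close>. Since \<open>sinh s \<ge> s\<close>, we get \<open>w \<le> s\<close>,
  and since sinh is convex with \<open>sinh \<alpha>\<^sub>0 = 1\<close> and \<open>t \<le> 1\<close>, we get \<open>w \<ge> \<alpha>\<^sub>0 t\<close>.
\<close>

section \<open>The Bessel function as a power series\<close>

definition bessel_coeff :: "real \<Rightarrow> nat \<Rightarrow> real" where
  "bessel_coeff \<nu> k = 1 / (fact k * Gamma (real k + \<nu> + 1))"

text \<open>Splitting off \<open>(x / 2) powr \<nu>\<close> from the Bessel function leaves this
  ordinary power series, evaluated at \<open>z = (x / 2)\<^sup>2\<close>; Cauchy products then
  apply.\<close>

definition bessel_series :: "real \<Rightarrow> real \<Rightarrow> real" where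
  "bessel_series \<nu> z = (\<Sum>k. bessel_coeff \<nu> k * z ^ k)"

lemma Gamma_real_plus1:
  fixes z :: real
  assumes "z > 0"
  shows "Gamma (z + 1) = z * Gamma z"
  using assms by (intro Gamma_plus1) auto

text \<open>Aligns a series multiplied by \<open>z\<close> with the other power series: the factor
  raises every exponent by one and leaves 0 as constant term.\<close>

lemma sums_shift:
  fixes f :: "nat \<Rightarrow> real"
  assumes "f sums l"
  shows "(\<lambda>k. case k of 0 \<Rightarrow> 0 | Suc n \<Rightarrow> f n) sums l"
  using sums_Suc[of "\<lambda>k. case k of 0 \<Rightarrow> 0 | Suc n \<Rightarrow> f n" l] assms by simp

lemma bessel_coeff_pos: "\<nu> \<ge> 0 \<Longrightarrow> bessel_coeff \<nu> k > 0"
  by (simp add: bessel_coeff_def add_nonneg_pos)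

text \<open>Passing from \<open>k\<close> to \<open>Suc k\<close> divides by
  \<open>(k + 1) * (k + \<nu> + 1)\<close>, whose second factor is at least 1. The exponential
  series thus dominates, which gives absolute convergence.\<close>

lemma bessel_coeff_0_le:
  assumes "\<nu> \<ge> 0"
  shows "bessel_coeff \<nu> k \<le> bessel_coeff \<nu> 0 / fact k"
proof (induction k)
  case (Suc k)
  have "bessel_coeff \<nu> (Suc k) = bessel_coeff \<nu> k / (real (Suc k) * (real k + \<nu> + 1))"
    using Gamma_real_plus1[of "real k + \<nu> + 1"] assms
    by (simp add: bessel_coeff_def add_ac)
  also have "\<dots> \<le> bessel_coeff \<nu> k / (real (Suc k) * 1)"
    using assms bessel_coeff_pos[OF assms, of k] by (intro divide_left_mono mult_left_mono) auto
  also have "\<dots> \<le> bessel_coeff \<nu> 0 / fact k / real (Suc k)"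
    unfolding mult_1_right using Suc by (rule divide_right_mono) simp
  finally show ?case by (simp add: field_simps)
qed simp

lemma summable_norm_bessel_series:
  assumes "\<nu> \<ge> 0"
  shows "summable (\<lambda>k. norm (bessel_coeff \<nu> k * z ^ k))"
proof (rule summable_comparison_test')
  show "summable (\<lambda>k. bessel_coeff \<nu> 0 * (inverse (fact k) * \<bar>z\<bar> ^ k))"
    by (intro summable_mult summable_exp)
  show "norm (norm (bessel_coeff \<nu> k * z ^ k)) \<le> bessel_coeff \<nu> 0 * (inverse (fact k) * \<bar>z\<bar> ^ k)"
    for k
    using mult_right_mono[OF bessel_coeff_0_le[OF assms, of k], of "\<bar>z\<bar> ^ k"]
      bessel_coeff_pos[OF assms, of k]
    by (simp add: abs_mult power_abs field_simps)
qed

lemma bessel_series_sums: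
  assumes "\<nu> \<ge> 0"
  shows "(\<lambda>k. bessel_coeff \<nu> k * z ^ k) sums bessel_series \<nu> z"
  using summable_norm_bessel_series[OF assms, of z, THEN summable_norm_cancel]
  by (simp add: bessel_series_def summable_sums)

lemma bessel_series_pos:
  assumes "\<nu> \<ge> 0" "z \<ge> 0"
  shows "bessel_series \<nu> z > 0"
proof -
  have "0 < (\<Sum>k\<in>{0}. bessel_coeff \<nu> k * z ^ k)"
    using bessel_coeff_pos[OF assms(1)] by simp
  also have "\<dots> \<le> bessel_series \<nu> z"
    unfolding bessel_series_def using assms bessel_coeff_pos[OF assms(1)]
    by (intro sum_le_suminf summable_norm_cancel[OF summable_norm_bessel_series])
      (auto simp: less_imp_le)
  finally show ?thesis .
qed

lemma bessel_I_eq: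
  assumes "\<nu> \<ge> 0" "x > 0"
  shows "bessel_I \<nu> x = (x / 2) powr \<nu> * bessel_series \<nu> ((x / 2)\<^sup>2)"
proof -
  have "1 / (fact k * Gamma (real k + \<nu> + 1)) * (x / 2) powr (2 * real k + \<nu>)
      = (x / 2) powr \<nu> * (bessel_coeff \<nu> k * ((x / 2)\<^sup>2) ^ k)" for k
  proof -
    have "(x / 2) powr (2 * real k + \<nu>) = ((x / 2)\<^sup>2) ^ k * (x / 2) powr \<nu>"
      using assms powr_realpow[of "x / 2" "2 * k"] by (simp add: powr_add power_mult)
    then show ?thesis by (simp add: bessel_coeff_def)
  qed
  then show ?thesis
    using sums_mult[OF bessel_series_sums[OF assms(1)]] by (simp add: bessel_I_def sums_iff)
qed

text \<open>The three-term recurrence between the orders \<nu>, \<nu> + 1 and \<nu> + 2, with the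
  powers of \<open>x / 2\<close> divided out.\<close>

lemma bessel_series_recurrence:
  assumes "\<nu> \<ge> 0"
  shows "bessel_series \<nu> z = (\<nu> + 1) * bessel_series (\<nu> + 1) z + z * bessel_series (\<nu> + 2) z"
proof -
  let ?g = "\<lambda>k. case k of 0 \<Rightarrow> 0 | Suc n \<Rightarrow> z * (bessel_coeff (\<nu> + 2) n * z ^ n)"
  have "?g sums (z * bessel_series (\<nu> + 2) z)"
    using assms by (intro sums_shift sums_mult bessel_series_sums) auto
  moreover have "(\<lambda>k. (\<nu> + 1) * (bessel_coeff (\<nu> + 1) k * z ^ k)) sums
      ((\<nu> + 1) * bessel_series (\<nu> + 1) z)"
    using assms by (intro sums_mult bessel_series_sums) auto
  ultimately have "(\<lambda>k. (\<nu> + 1) * (bessel_coeff (\<nu> + 1) k * z ^ k) + ?g k) sums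
      ((\<nu> + 1) * bessel_series (\<nu> + 1) z + z * bessel_series (\<nu> + 2) z)"
    by (intro sums_add)
  moreover have "(\<nu> + 1) * (bessel_coeff (\<nu> + 1) k * z ^ k) + ?g k = bessel_coeff \<nu> k * z ^ k" for k
  proof (cases k)
    case 0
    then show ?thesis
      using Gamma_real_plus1[of "\<nu> + 1"] assms by (simp add: bessel_coeff_def add_ac)
  next
    case (Suc n)
    have coeff: "(\<nu> + 1) * bessel_coeff (\<nu> + 1) (Suc n) + bessel_coeff (\<nu> + 2) n =
      bessel_coeff \<nu> (Suc n)"
    proof -
      define G where "G = Gamma (real n + \<nu> + 2)"
      have "G > 0" using assms by (simp add: G_def)
      have "Gamma (real n + \<nu> + 3) = (real n + \<nu> + 2) * G"
        using Gamma_real_plus1[of "real n + \<nu> + 2"] assms by (simp add: G_def add_ac)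
      then have "bessel_coeff (\<nu> + 1) (Suc n) = 1 / (real (Suc n) * fact n * ((real n + \<nu> + 2) * G))"
        "bessel_coeff (\<nu> + 2) n = 1 / (fact n * ((real n + \<nu> + 2) * G))"
        "bessel_coeff \<nu> (Suc n) = 1 / (real (Suc n) * fact n * G)"
        by (simp_all add: bessel_coeff_def G_def add_ac)
      \<comment> \<open>Over the common denominator \<open>K * F * M * G\<close> the numerator is
        \<open>\<nu> + 1 + K\<close>, which equals \<open>M\<close> and cancels.\<close>
      moreover have "(\<nu> + 1) * (1 / (K * F * (M * G))) + 1 / (F * (M * G)) = 1 / (K * F * G)"
        if "M = \<nu> + 1 + K" "M > 0" "K > 0" "F > 0" for M K F :: real
        using that \<open>G > 0\<close> by (simp add: divide_simps)
      from this[of "real n + \<nu> + 2" "real (Suc n)" "fact n"]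
      have "(\<nu> + 1) * (1 / (real (Suc n) * fact n * ((real n + \<nu> + 2) * G))) +
        1 / (fact n * ((real n + \<nu> + 2) * G)) = 1 / (real (Suc n) * fact n * G)"
        using assms by simp
      ultimately show ?thesis by simp
    qed
    then show ?thesis using Suc by (simp add: algebra_simps flip: coeff)
  qed
  ultimately show ?thesis
    using bessel_series_sums[OF assms, of z] sums_unique2 by simp
qed

section \<open>Products of two Bessel series\<close>

definition bessel_prod_coeff :: "real \<Rightarrow> real \<Rightarrow> nat \<Rightarrow> real" where
  "bessel_prod_coeff \<mu> \<nu> k = Gamma (\<mu> + \<nu> + 2 * real k + 1) /
     (fact k * Gamma (\<mu> + \<nu> + real k + 1) * Gamma (\<mu> + real k + 1) * Gamma (\<nu> + real k + 1))"

text \<open>Lets the Gamma arguments take any convenient normal form when orders and indices are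
  shifted.\<close>

lemma bessel_prod_coeff_eq:
  assumes "\<mu> + \<nu> + 2 * real k + 1 = a" "\<mu> + \<nu> + real k + 1 = b" "\<mu> + real k + 1 = c"
    "\<nu> + real k + 1 = d"
  shows "bessel_prod_coeff \<mu> \<nu> k = Gamma a / (fact k * Gamma b * Gamma c * Gamma d)"
  using assms by (simp add: bessel_prod_coeff_def)

lemma gbinomial_Gamma_real:
  fixes z :: real
  assumes "z \<ge> 0"
  shows "z gchoose n = Gamma (z + 1) / (fact n * Gamma (z - real n + 1))"
  using assms by (intro gbinomial_Gamma) auto

text \<open>Multiplying by \<open>Gamma (\<mu> + k + 1) * Gamma (\<nu> + k + 1)\<close> turns each
  summand into a product of two generalized binomial coefficients, with the two orders crossed over;
  Vandermonde sums them.\<close>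

lemma bessel_coeff_convolution:
  assumes "\<mu> \<ge> 0" "\<nu> \<ge> 0"
  shows "(\<Sum>j\<le>k. bessel_coeff \<mu> j * bessel_coeff \<nu> (k - j)) = bessel_prod_coeff \<mu> \<nu> k"
proof -
  define P Q where "P = Gamma (\<mu> + real k + 1)" and "Q = Gamma (\<nu> + real k + 1)"
  have pos: "P > 0" "Q > 0" using assms by (auto simp: P_def Q_def)
  have "bessel_coeff \<mu> j * bessel_coeff \<nu> (k - j) =
      ((\<nu> + real k) gchoose j) * ((\<mu> + real k) gchoose (k - j)) / (P * Q)" if "j \<le> k" for j
  proof -
    have "(\<nu> + real k) gchoose j = Q / (fact j * Gamma (real (k - j) + \<nu> + 1))"
      using assms that by (subst gbinomial_Gamma_real) (auto simp: Q_def of_nat_diff algebra_simps)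
    moreover have "(\<mu> + real k) gchoose (k - j) = P / (fact (k - j) * Gamma (real j + \<mu> + 1))"
      using assms that by (subst gbinomial_Gamma_real) (auto simp: P_def of_nat_diff algebra_simps)
    ultimately show ?thesis using pos by (simp add: bessel_coeff_def field_simps)
  qed
  then have "(\<Sum>j\<le>k. bessel_coeff \<mu> j * bessel_coeff \<nu> (k - j)) =
      (\<Sum>j\<le>k. ((\<nu> + real k) gchoose j) * ((\<mu> + real k) gchoose (k - j))) / (P * Q)"
    by (simp add: sum_divide_distrib)
  also have "\<dots> = ((\<nu> + real k + (\<mu> + real k)) gchoose k) / (P * Q)"
    by (simp add: atMost_atLeast0 gbinomial_Vandermonde)
  also have "\<dots> = bessel_prod_coeff \<mu> \<nu> k"
    using assms
    by (subst gbinomial_Gamma_real) (auto simp: bessel_prod_coeff_def P_def Q_def algebra_simps)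
  finally show ?thesis .
qed

lemma bessel_series_mult_sums:
  assumes "\<mu> \<ge> 0" "\<nu> \<ge> 0"
  shows "(\<lambda>k. bessel_prod_coeff \<mu> \<nu> k * z ^ k) sums (bessel_series \<mu> z * bessel_series \<nu> z)"
proof -
  have "(\<Sum>j\<le>k. (bessel_coeff \<mu> j * z ^ j) * (bessel_coeff \<nu> (k - j) * z ^ (k - j))) =
      bessel_prod_coeff \<mu> \<nu> k * z ^ k" for k
    unfolding bessel_coeff_convolution[OF assms, symmetric] sum_distrib_right
    by (intro sum.cong) (auto simp: mult_ac simp flip: power_add)
  then show ?thesis
    using Cauchy_product_sums[OF assms[THEN summable_norm_bessel_series], of z z]
    by (simp add: bessel_series_def)
qed

section \<open>Quadratic inequalities by comparison of coefficients\<close>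

lemma bessel_series_Turan:
  assumes "\<nu> \<ge> 0" "z \<ge> 0"
  shows "bessel_series \<nu> z * bessel_series (\<nu> + 2) z \<le> (bessel_series (\<nu> + 1) z)\<^sup>2"
  unfolding power2_eq_square
proof (rule sums_le)
  show "(\<lambda>k. bessel_prod_coeff \<nu> (\<nu> + 2) k * z ^ k) sums
      (bessel_series \<nu> z * bessel_series (\<nu> + 2) z)"
    using assms by (intro bessel_series_mult_sums) auto
  show "(\<lambda>k. bessel_prod_coeff (\<nu> + 1) (\<nu> + 1) k * z ^ k) sums
      (bessel_series (\<nu> + 1) z * bessel_series (\<nu> + 1) z)"
    using assms by (intro bessel_series_mult_sums) auto
  fix k
  define G H B where "G = Gamma (2 * \<nu> + 2 * real k + 3)" and "H = Gamma (2 * \<nu> + real k + 3)"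
    and "B = Gamma (\<nu> + real k + 1)"
  define m where "m = \<nu> + real k + 1"
  have pos: "G > 0" "H > 0" "B > 0" "m > 0" using assms by (auto simp: G_def H_def B_def m_def)
  have "Gamma (\<nu> + real k + 2) = m * B" "Gamma (\<nu> + real k + 3) = (m + 1) * (m * B)"
    using Gamma_real_plus1[of m] Gamma_real_plus1[of "m + 1"] pos
    by (simp_all add: B_def m_def add_ac)
  moreover have
    "bessel_prod_coeff \<nu> (\<nu> + 2) k = G / (fact k * H * B * Gamma (\<nu> + real k + 3))"
    "bessel_prod_coeff (\<nu> + 1) (\<nu> + 1) k =
      G / (fact k * H * Gamma (\<nu> + real k + 2) * Gamma (\<nu> + real k + 2))"
    unfolding G_def H_def B_def by (rule bessel_prod_coeff_eq; simp)+
  \<comment> \<open>The left coefficient is the right one times \<open>m / (m + 1)\<close>.\<close>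
  moreover have "G / (fact k * H * B * ((m + 1) * (m * B))) \<le> G / (fact k * H * (m * B) * (m * B))"
  proof (rule divide_left_mono)
    have "0 \<le> fact k * H * B * (m * B)" using pos by simp
    then show "fact k * H * (m * B) * (m * B) \<le> fact k * H * B * ((m + 1) * (m * B))"
      by (simp add: algebra_simps)
  qed (use pos in simp_all)
  ultimately have "bessel_prod_coeff \<nu> (\<nu> + 2) k \<le> bessel_prod_coeff (\<nu> + 1) (\<nu> + 1) k"
    by simp
  then show "bessel_prod_coeff \<nu> (\<nu> + 2) k * z ^ k \<le> bessel_prod_coeff (\<nu> + 1) (\<nu> + 1) k * z ^ k"
    using assms by (simp add: mult_right_mono)
qed

text \<open>The comparison at \<open>z ^ Suc n\<close> for the quadratic inequality below; the first
  term has index \<open>n\<close> because a factor \<open>z\<close> stands before its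
  series.\<close>

lemma bessel_prod_coeff_Suc_le:
  assumes "\<nu> \<ge> 0"
  shows "bessel_prod_coeff (\<nu> + 1) (\<nu> + 1) n + (\<nu> + 1 / 2) * bessel_prod_coeff \<nu> (\<nu> + 1) (Suc n)
    \<le> bessel_prod_coeff \<nu> \<nu> (Suc n)"
proof -
  define G A B where "G = Gamma (2 * \<nu> + 2 * real n + 3)" and "A = Gamma (2 * \<nu> + real n + 2)"
    and "B = Gamma (\<nu> + real n + 2)"
  define a b g where "a = 2 * \<nu> + real n + 2" and "b = \<nu> + real n + 2"
    and "g = 2 * \<nu> + 2 * real n + 3"
  \<comment> \<open>With \<open>q\<close> factored out, the three coefficients become polynomials in
    \<nu> and \<open>n\<close>.\<close>
  define q where "q = G / (real (Suc n) * fact n * (a * A) * B * (b * B))"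
  have pos: "G > 0" "A > 0" "B > 0" "a > 0" "b > 0" "g > 0"
    using assms by (auto simp: G_def A_def B_def a_def b_def g_def)
  have rec: "Gamma (2 * \<nu> + 2 * real n + 4) = g * G" "Gamma (2 * \<nu> + real n + 3) = a * A"
    "Gamma (\<nu> + real n + 3) = b * B"
    using Gamma_real_plus1[of g] Gamma_real_plus1[of a] Gamma_real_plus1[of b] pos
    by (simp_all add: G_def A_def B_def a_def b_def g_def add_ac)
  have coeffs: "bessel_prod_coeff (\<nu> + 1) (\<nu> + 1) n = G / (fact n * (a * A) * B * B)"
    "bessel_prod_coeff \<nu> (\<nu> + 1) (Suc n) = g * G / (fact (Suc n) * (a * A) * B * (b * B))"
    "bessel_prod_coeff \<nu> \<nu> (Suc n) = G / (fact (Suc n) * A * B * B)"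
    unfolding rec[symmetric] unfolding G_def A_def B_def by (rule bessel_prod_coeff_eq; simp)+
  define K where "K = real (Suc n)"
  have "K > 0" and fact_eq: "fact (Suc n) = K * fact n" by (simp_all add: K_def)
  have coeffs_q: "bessel_prod_coeff (\<nu> + 1) (\<nu> + 1) n = q * (K * b)"
    "bessel_prod_coeff \<nu> (\<nu> + 1) (Suc n) = q * g"
    "bessel_prod_coeff \<nu> \<nu> (Suc n) = q * (a * b)"
    unfolding coeffs fact_eq q_def K_def[symmetric] using pos \<open>K > 0\<close> by simp_all
  \<comment> \<open>Since \<open>a - K = 2 * \<nu> + 1\<close> and \<open>2 * b = g + 1\<close>, the
    two sides differ by exactly \<open>\<nu> + 1 / 2\<close>.\<close>
  have "K * b + (\<nu> + 1 / 2) * g \<le> a * b"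
    using assms by (simp add: K_def a_def b_def g_def algebra_simps)
  then have "q * (K * b + (\<nu> + 1 / 2) * g) \<le> q * (a * b)"
    using pos by (intro mult_left_mono) (auto simp: q_def)
  then show ?thesis unfolding coeffs_q by (simp add: distrib_left mult.left_commute)
qed

text \<open>For \<open>z = (x / 2)\<^sup>2\<close> this is
  \<open>r\<^sup>2 + 2 * t * r \<le> 1\<close>, cleared of denominators.\<close>

lemma bessel_series_quadratic_le:
  assumes "\<nu> \<ge> 0" "z \<ge> 0"
  shows "z * (bessel_series (\<nu> + 1) z)\<^sup>2 + (\<nu> + 1 / 2) * (bessel_series \<nu> z * bessel_series (\<nu> + 1) z)
    \<le> (bessel_series \<nu> z)\<^sup>2"
  unfolding power2_eq_square
proof (rule sums_le)
  let ?g = "\<lambda>k. case k of 0 \<Rightarrow> 0 | Suc n \<Rightarrow> z * (bessel_prod_coeff (\<nu> + 1) (\<nu> + 1) n * z ^ n)"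
  let ?h = "\<lambda>k. (\<nu> + 1 / 2) * (bessel_prod_coeff \<nu> (\<nu> + 1) k * z ^ k)"
  have "?g sums (z * (bessel_series (\<nu> + 1) z * bessel_series (\<nu> + 1) z))"
    using assms by (intro sums_shift sums_mult bessel_series_mult_sums) auto
  moreover have "?h sums ((\<nu> + 1 / 2) * (bessel_series \<nu> z * bessel_series (\<nu> + 1) z))"
    using assms by (intro sums_mult bessel_series_mult_sums) auto
  ultimately show "(\<lambda>k. ?g k + ?h k) sums
      (z * (bessel_series (\<nu> + 1) z * bessel_series (\<nu> + 1) z) +
       (\<nu> + 1 / 2) * (bessel_series \<nu> z * bessel_series (\<nu> + 1) z))"
    by (rule sums_add)
  show "(\<lambda>k. bessel_prod_coeff \<nu> \<nu> k * z ^ k) sums (bessel_series \<nu> z * bessel_series \<nu> z)"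
    using assms by (intro bessel_series_mult_sums) auto
  show "?g k + ?h k \<le> bessel_prod_coeff \<nu> \<nu> k * z ^ k" for k
  proof (cases k)
    case 0
    define B where "B = Gamma (\<nu> + 1)"
    have "B > 0" using assms by (simp add: B_def)
    have rec: "Gamma (\<nu> + 2) = (\<nu> + 1) * B"
      using Gamma_real_plus1[of "\<nu> + 1"] assms by (simp add: B_def add_ac)
    have "bessel_prod_coeff \<nu> (\<nu> + 1) 0 =
        Gamma (2 * \<nu> + 2) / (fact 0 * Gamma (2 * \<nu> + 2) * B * ((\<nu> + 1) * B))"
      "bessel_prod_coeff \<nu> \<nu> 0 = Gamma (2 * \<nu> + 1) / (fact 0 * Gamma (2 * \<nu> + 1) * B * B)"
      unfolding rec[symmetric] unfolding B_def by (rule bessel_prod_coeff_eq; simp)+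
    moreover have "Gamma (2 * \<nu> + 1) > 0" "Gamma (2 * \<nu> + 2) > 0"
      using assms by simp_all
    ultimately have "bessel_prod_coeff \<nu> (\<nu> + 1) 0 = 1 / (B * ((\<nu> + 1) * B))"
      "bessel_prod_coeff \<nu> \<nu> 0 = 1 / (B * B)"
      by simp_all
    \<comment> \<open>The shifted series has no constant term, so index 0 only asks for
      \<open>\<nu> + 1 / 2 \<le> \<nu> + 1\<close>.\<close>
    moreover have "(\<nu> + 1 / 2) * (1 / (B * ((\<nu> + 1) * B))) \<le> 1 / (B * B)"
      using \<open>B > 0\<close> assms by (simp add: divide_simps)
    ultimately show ?thesis using 0 by simp
  next
    case (Suc n)
    then show ?thesis
      using mult_right_mono[OF bessel_prod_coeff_Suc_le[OF assms(1), of n], of "z ^ Suc n"] assms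
      by (simp add: algebra_simps)
  qed
qed

section \<open>From the quadratic inequalities to the exponential bounds\<close>

lemma sinh_mult_le:
  fixes a t :: real
  assumes "a \<ge> 0" "0 \<le> t" "t \<le> 1"
  shows "sinh (a * t) \<le> t * sinh a"
proof -
  have "convex_on {0..} (sinh :: real \<Rightarrow> real)"
    by (rule f''_ge0_imp_convex[where f' = cosh and f'' = sinh])
      (auto intro!: derivative_eq_intros)
  \<comment> \<open>The chord runs from 0 to \<open>a\<close>, and
    \<open>sinh 0 = 0\<close>.\<close>
  from convex_onD[OF this, of t 0 a] assms show ?thesis by (simp add: mult.commute)
qed

theorem corollary1:
  fixes \<nu> x \<alpha>\<^sub>0 :: real
  assumes "\<nu> \<ge> 0" and "x \<ge> 0"
    and "\<alpha>\<^sub>0 = - ln (sqrt 2 - 1)"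
    and "\<nu> + 1 \<le> x"
  shows "exp (- ((\<nu> + 1) / x)) \<le> bessel_I (\<nu> + 1) x / bessel_I \<nu> x
    \<and> bessel_I (\<nu> + 1) x / bessel_I \<nu> x \<le> exp (- \<alpha>\<^sub>0 * ((\<nu> + 1 / 2) / x))"
proof -
  \<comment> \<open>Positivity of \<open>x\<close> keeps the argument away from the degenerate value
    \<open>0 powr 0 = 0\<close>.\<close>
  have "x > 0" using assms by linarith
  define y s t where "y = x / 2" and "s = (\<nu> + 1) / x" and "t = (\<nu> + 1 / 2) / x"
  define J where "J = (\<lambda>\<mu>. bessel_series \<mu> (y\<^sup>2))"
  have "y > 0" and y: "y * (2 * s) = \<nu> + 1" "y * (2 * t) = \<nu> + 1 / 2"
    using \<open>x > 0\<close> by (auto simp: y_def s_def t_def)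
  have J_pos: "J \<nu> > 0" "J (\<nu> + 1) > 0"
    using assms by (auto simp: J_def intro!: bessel_series_pos)
  define r where "r = y * J (\<nu> + 1) / J \<nu>"
  have "r > 0" using J_pos \<open>y > 0\<close> by (simp add: r_def)
  have ratio: "bessel_I (\<nu> + 1) x / bessel_I \<nu> x = r"
    using \<open>x > 0\<close> assms(1) \<open>y > 0\<close>
    by (simp add: bessel_I_eq powr_add r_def J_def y_def)
  have r_J: "r * J \<nu> = y * J (\<nu> + 1)" using J_pos by (simp add: r_def)

  \<comment> \<open>The recurrence is multiplied by \<open>J \<nu>\<close> so that the Turan
    inequality can replace \<open>J \<nu> * J (\<nu> + 2)\<close>; cancelling
    \<open>(J \<nu>)\<^sup>2\<close> at the end leaves a bound in \<open>r\<close> alone.\<close>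
  have "(J \<nu>)\<^sup>2 = (\<nu> + 1) * (J \<nu> * J (\<nu> + 1)) + y\<^sup>2 * (J \<nu> * J (\<nu> + 2))"
    using bessel_series_recurrence[OF assms(1), of "y\<^sup>2"]
    by (simp add: J_def power2_eq_square algebra_simps)
  also have "\<dots> \<le> (\<nu> + 1) * (J \<nu> * J (\<nu> + 1)) + y\<^sup>2 * (J (\<nu> + 1))\<^sup>2"
    using bessel_series_Turan[OF assms(1), of "y\<^sup>2"] by (simp add: J_def mult_left_mono)
  also have "\<dots> = 2 * s * J \<nu> * (y * J (\<nu> + 1)) + (y * J (\<nu> + 1))\<^sup>2"
    unfolding y(1)[symmetric] by (simp add: power_mult_distrib mult_ac)
  also have "\<dots> = (r\<^sup>2 + 2 * s * r) * (J \<nu>)\<^sup>2"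
    unfolding r_J[symmetric] by (simp add: power2_eq_square algebra_simps)
  finally have lower: "1 \<le> r\<^sup>2 + 2 * s * r" using J_pos by simp

  have "(r\<^sup>2 + 2 * t * r) * (J \<nu>)\<^sup>2 = 2 * t * J \<nu> * (y * J (\<nu> + 1)) + (y * J (\<nu> + 1))\<^sup>2"
    unfolding r_J[symmetric] by (simp add: power2_eq_square algebra_simps)
  also have "\<dots> = (\<nu> + 1 / 2) * (J \<nu> * J (\<nu> + 1)) + y\<^sup>2 * (J (\<nu> + 1))\<^sup>2"
    unfolding y(2)[symmetric] by (simp add: power_mult_distrib mult_ac)
  also have "\<dots> \<le> 1 * (J \<nu>)\<^sup>2"
    using bessel_series_quadratic_le[OF assms(1), of "y\<^sup>2"] by (simp add: J_def add_ac)
  finally have upper: "r\<^sup>2 + 2 * t * r \<le> 1"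
    using J_pos mult_le_cancel_right_pos[of "(J \<nu>)\<^sup>2"] by simp

  define w where "w = - ln r"
  \<comment> \<open>As \<open>sinh (- ln r) = (1 / r - r) / 2\<close>, both quadratic bounds on
    \<open>r\<close> become linear bounds on \<open>sinh w\<close>.\<close>
  have "2 * r * sinh w = 1 - r\<^sup>2"
    using \<open>r > 0\<close> by (simp add: w_def sinh_ln_real power2_eq_square field_simps)
  with lower upper have "r * t \<le> r * sinh w" "r * sinh w \<le> r * s"
    by (simp_all add: mult_ac)
  then have w: "t \<le> sinh w" "sinh w \<le> s" using \<open>r > 0\<close> by simp_all

  have "s \<ge> 0" using assms by (simp add: s_def)
  then have "s \<le> sinh s"
    using real_le_x_sinh[of s] by (simp add: sinh_field_def exp_minus)
  with w have "w \<le> s" by (metis order_trans sinh_real_le_iff)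

  \<comment> \<open>The reciprocal shows \<open>exp \<alpha>\<^sub>0 = sqrt 2 + 1\<close>, so
    \<open>sinh \<alpha>\<^sub>0\<close> is half of
    \<open>(sqrt 2 + 1) - (sqrt 2 - 1)\<close>.\<close>
  have "(sqrt 2 - 1) * (sqrt 2 + 1) = 1" by (simp add: algebra_simps)
  then have "inverse (sqrt 2 - 1) = sqrt 2 + 1" by (metis inverse_unique)
  then have "sinh \<alpha>\<^sub>0 = 1" by (simp add: assms(3) sinh_ln_real)
  then have "\<alpha>\<^sub>0 \<ge> 0" using sinh_real_nonneg_iff[of \<alpha>\<^sub>0] by simp
  \<comment> \<open>The hypothesis \<open>\<nu> + 1 \<le> x\<close> gives \<open>t \<le> 1\<close>,
    the range in which the chord lies above sinh.\<close>
  moreover have "0 \<le> t" "t \<le> 1" using assms \<open>x > 0\<close> by (auto simp: t_def)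
  ultimately have "sinh (\<alpha>\<^sub>0 * t) \<le> t"
    using sinh_mult_le[of \<alpha>\<^sub>0 t] \<open>sinh \<alpha>\<^sub>0 = 1\<close> by simp
  with w have "\<alpha>\<^sub>0 * t \<le> w" by (metis order_trans sinh_real_le_iff)

  have "r = exp (- w)" using \<open>r > 0\<close> by (simp add: w_def)
  then show ?thesis
    using \<open>w \<le> s\<close> \<open>\<alpha>\<^sub>0 * t \<le> w\<close> unfolding ratio by (simp add: s_def t_def)
qed

end
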